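(* Let $S\to S_1$ and $S\to S_2$ be homomorphisms of affine semigroups. The affine semigroup $S_1\,\widetilde{\oplus}_S\,S_2$ (together with the canonical homomorphisms from $S_1$ and $S_2$) is the fibered sum of $S_1$ and $S_2$ over $S$ in the category of affine semigroups.
   Context: Monoids are commutative, written additively with identity $0$; homomorphisms preserve $+$ and $0$. An affine semigroup is a finitely generated, cancellative, torsion-free monoid (torsion free: $ns_1=ns_2$ for some positive integer $n$ implies $s_1=s_2$). $\mathrm{Grp}(S)=\{s-t:s,t\in S\}$ is the group of differences of a cancellative monoid. $S_1\oplus_S S_2$ denotes the image of the composite $S_1\oplus S_2\to\mathrm{Grp}(S_1)\oplus\mathrm{Grp}(S_2)\to(\mathrm{Grp}(S_1)\oplus\mathrm{Grp}(S_2))/\{(s,-s):s\in\mathrm{Grp}(S)\}$ (elements of $\mathrm{Grp}(S)$ being identified with their images), and $S_1\,\widetilde{\oplus}_S\,S_2:=(S_1\oplus_S S_2)/\!\sim_{\mathrm{tor}}$, where $x\sim_{\mathrm{tor}}y$ iff $nx=ny$ for some positive integer $n$. The canonical homomorphisms $S_i\to S_1\,\widetilde{\oplus}_S\,S_2$ are the composites of $S_i\to S_1\oplus S_2$ with these maps. The fibered sum of $S\to S_1$ and $S\to S_2$ in a category is their pushout: an object $P$ with morphisms $S_1\to P$, $S_2\to P$ making the square commute, such that for any object $T$ with morphisms $S_1\to T$, $S_2\to T$ agreeing on $S$, there is a unique morphism $P\to T$ compatible with them. *)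

theory Defs
  imports "HOL-Algebra.Coset" "HOL-Algebra.Divisibility"
begin

(* Monoids are HOL-Algebra monoids. They are written multiplicatively in that library: s + t is
   s \<otimes> t, 0 is \<one>, and n s is s [^] n. *)

definition mon_hom :: "('a, 'm) monoid_scheme \<Rightarrow> ('b, 'n) monoid_scheme \<Rightarrow> ('a \<Rightarrow> 'b) set" where
  "mon_hom M N = {h \<in> hom M N. h \<one>\<^bsub>M\<^esub> = \<one>\<^bsub>N\<^esub>}"

definition fin_gen_monoid :: "('a, 'm) monoid_scheme \<Rightarrow> bool" where
  "fin_gen_monoid M \<longleftrightarrow>
     (\<exists>A. finite A \<and> A \<subseteq> carrier M \<and> carrier M = \<Inter>{H. submonoid H M \<and> A \<subseteq> H})"

definition torsion_free_monoid :: "('a, 'm) monoid_scheme \<Rightarrow> bool" where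
  "torsion_free_monoid M \<longleftrightarrow>
     (\<forall>x\<in>carrier M. \<forall>y\<in>carrier M. \<forall>n::nat. n > 0 \<longrightarrow> x [^]\<^bsub>M\<^esub> n = y [^]\<^bsub>M\<^esub> n \<longrightarrow> x = y)"

definition affine_semigroup :: "('a, 'm) monoid_scheme \<Rightarrow> bool" where
  "affine_semigroup M \<longleftrightarrow>
     comm_monoid_cancel M \<and> fin_gen_monoid M \<and> torsion_free_monoid M"

(* Quotient of M by a congruence r. The union is over all pairs of representatives; it is a single
   class exactly because r is a congruence. *)
definition quot_monoid :: "('a, 'm) monoid_scheme \<Rightarrow> ('a \<times> 'a) set \<Rightarrow> 'a set monoid" where
  "quot_monoid M r =
     \<lparr>carrier = carrier M // r,
      mult = (\<lambda>C D. \<Union>x\<in>C. \<Union>y\<in>D. r `` {x \<otimes>\<^bsub>M\<^esub> y}),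
      one = r `` {\<one>\<^bsub>M\<^esub>}\<rparr>"

(* The pair (a, b) represents the difference a - b. *)
definition diff_rel :: "('a, 'm) monoid_scheme \<Rightarrow> (('a \<times> 'a) \<times> ('a \<times> 'a)) set" where
  "diff_rel M = {((a, b), (c, d)). a \<in> carrier M \<and> b \<in> carrier M \<and> c \<in> carrier M \<and> d \<in> carrier M
                   \<and> a \<otimes>\<^bsub>M\<^esub> d = c \<otimes>\<^bsub>M\<^esub> b}"

definition Grp :: "('a, 'm) monoid_scheme \<Rightarrow> ('a \<times> 'a) set monoid" where
  "Grp M = quot_monoid (M \<times>\<times> M) (diff_rel M)"

definition to_Grp :: "('a, 'm) monoid_scheme \<Rightarrow> 'a \<Rightarrow> ('a \<times> 'a) set" where
  "to_Grp M a = diff_rel M `` {(a, \<one>\<^bsub>M\<^esub>)}"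

(* The homomorphism from Grp M to Grp N induced by f : M \<rightarrow> N, sending a - b to f a - f b. *)
definition Grp_map :: "('b, 'n) monoid_scheme \<Rightarrow> ('a \<Rightarrow> 'b) \<Rightarrow> ('a \<times> 'a) set \<Rightarrow> ('b \<times> 'b) set" where
  "Grp_map N f C = (\<Union>(a, b)\<in>C. diff_rel N `` {(f a, f b)})"

definition antidiag ::
  "'s monoid \<Rightarrow> 'a monoid \<Rightarrow> 'b monoid \<Rightarrow> ('s \<Rightarrow> 'a) \<Rightarrow> ('s \<Rightarrow> 'b)
    \<Rightarrow> (('a \<times> 'a) set \<times> ('b \<times> 'b) set) set" where
  "antidiag S S1 S2 f g = (\<lambda>u. (Grp_map S1 f u, inv\<^bsub>Grp S2\<^esub> (Grp_map S2 g u))) ` carrier (Grp S)"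

definition to_amalg ::
  "'s monoid \<Rightarrow> 'a monoid \<Rightarrow> 'b monoid \<Rightarrow> ('s \<Rightarrow> 'a) \<Rightarrow> ('s \<Rightarrow> 'b) \<Rightarrow> 'a \<times> 'b
    \<Rightarrow> (('a \<times> 'a) set \<times> ('b \<times> 'b) set) set" where
  "to_amalg S S1 S2 f g p =
     antidiag S S1 S2 f g #>\<^bsub>Grp S1 \<times>\<times> Grp S2\<^esub> (to_Grp S1 (fst p), to_Grp S2 (snd p))"

definition amalg_sum ::
  "'s monoid \<Rightarrow> 'a monoid \<Rightarrow> 'b monoid \<Rightarrow> ('s \<Rightarrow> 'a) \<Rightarrow> ('s \<Rightarrow> 'b)
    \<Rightarrow> (('a \<times> 'a) set \<times> ('b \<times> 'b) set) set monoid" where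
  "amalg_sum S S1 S2 f g =
     ((Grp S1 \<times>\<times> Grp S2) Mod antidiag S S1 S2 f g)
       \<lparr>carrier := to_amalg S S1 S2 f g ` carrier (S1 \<times>\<times> S2)\<rparr>"

definition tor_rel :: "('a, 'm) monoid_scheme \<Rightarrow> ('a \<times> 'a) set" where
  "tor_rel M = {(x, y). x \<in> carrier M \<and> y \<in> carrier M
                  \<and> (\<exists>n::nat. n > 0 \<and> x [^]\<^bsub>M\<^esub> n = y [^]\<^bsub>M\<^esub> n)}"

definition tf_amalg_sum ::
  "'s monoid \<Rightarrow> 'a monoid \<Rightarrow> 'b monoid \<Rightarrow> ('s \<Rightarrow> 'a) \<Rightarrow> ('s \<Rightarrow> 'b)
    \<Rightarrow> (('a \<times> 'a) set \<times> ('b \<times> 'b) set) set set monoid" where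
  "tf_amalg_sum S S1 S2 f g =
     quot_monoid (amalg_sum S S1 S2 f g) (tor_rel (amalg_sum S S1 S2 f g))"

definition to_tf_amalg ::
  "'s monoid \<Rightarrow> 'a monoid \<Rightarrow> 'b monoid \<Rightarrow> ('s \<Rightarrow> 'a) \<Rightarrow> ('s \<Rightarrow> 'b) \<Rightarrow> 'a \<times> 'b
    \<Rightarrow> (('a \<times> 'a) set \<times> ('b \<times> 'b) set) set set" where
  "to_tf_amalg S S1 S2 f g p =
     tor_rel (amalg_sum S S1 S2 f g) `` {to_amalg S S1 S2 f g p}"

definition tf_inj1 ::
  "'s monoid \<Rightarrow> 'a monoid \<Rightarrow> 'b monoid \<Rightarrow> ('s \<Rightarrow> 'a) \<Rightarrow> ('s \<Rightarrow> 'b) \<Rightarrow> 'a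
    \<Rightarrow> (('a \<times> 'a) set \<times> ('b \<times> 'b) set) set set" where
  "tf_inj1 S S1 S2 f g a = to_tf_amalg S S1 S2 f g (a, \<one>\<^bsub>S2\<^esub>)"

definition tf_inj2 ::
  "'s monoid \<Rightarrow> 'a monoid \<Rightarrow> 'b monoid \<Rightarrow> ('s \<Rightarrow> 'a) \<Rightarrow> ('s \<Rightarrow> 'b) \<Rightarrow> 'b
    \<Rightarrow> (('a \<times> 'a) set \<times> ('b \<times> 'b) set) set set" where
  "tf_inj2 S S1 S2 f g b = to_tf_amalg S S1 S2 f g (\<one>\<^bsub>S1\<^esub>, b)"

(* (P, i1, i2) is the pushout of f : S \<rightarrow> S1 and g : S \<rightarrow> S2 in the category of affine semigroups.
   HOL cannot quantify over types inside a formula, so the test objects T have carrier in an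
   arbitrary type 't, passed as a type argument. Two functions are the same morphism if they agree
   on the carrier of the domain; extensionality picks one representative of each morphism. *)
definition is_affine_fibered_sum ::
  "'t itself \<Rightarrow> 's monoid \<Rightarrow> 'a monoid \<Rightarrow> 'b monoid \<Rightarrow> ('s \<Rightarrow> 'a) \<Rightarrow> ('s \<Rightarrow> 'b)
    \<Rightarrow> 'p monoid \<Rightarrow> ('a \<Rightarrow> 'p) \<Rightarrow> ('b \<Rightarrow> 'p) \<Rightarrow> bool" where
  "is_affine_fibered_sum (_ :: 't itself) S S1 S2 f g P i1 i2 \<longleftrightarrow>
     affine_semigroup P \<and> i1 \<in> mon_hom S1 P \<and> i2 \<in> mon_hom S2 P \<and>
     (\<forall>s\<in>carrier S. i1 (f s) = i2 (g s)) \<and>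
     (\<forall>(T :: 't monoid) h1 h2.
        affine_semigroup T \<and> h1 \<in> mon_hom S1 T \<and> h2 \<in> mon_hom S2 T \<and>
        (\<forall>s\<in>carrier S. h1 (f s) = h2 (g s)) \<longrightarrow>
        (\<exists>!h. h \<in> mon_hom P T \<and> h \<in> extensional (carrier P) \<and>
              (\<forall>a\<in>carrier S1. h (i1 a) = h1 a) \<and> (\<forall>b\<in>carrier S2. h (i2 b) = h2 b)))"

end

theory Submission
  imports Defs
begin

text \<open>
  The construction passes through two groups of differences, a quotient by a subgroup and a quotient
  by torsion, but all that matters about it is the surjective homomorphism
  \<open>to_tf_amalg\<close> from \<open>S1 \<times>\<times> S2\<close> and the pairs that it identifies. In additive notation,
  \<open>(a, b)\<close> and \<open>(a', b')\<close> become equal iff, for some \<open>n > 0\<close> and some \<open>s\<close>, \<open>t\<close> in \<open>S\<close>,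
  \<open>n a + f t = f s + n a'\<close> and \<open>n b + g s = g t + n b'\<close>: the difference of the two multiples is
  \<open>(f u, - g u)\<close> with \<open>u = s - t\<close> (\<open>to_amalg_eq_iff\<close>, \<open>to_tf_amalg_eq_iff\<close>).

  The universal property follows. If \<open>h1\<close> and \<open>h2\<close> agree on \<open>S\<close>, then
  \<open>(a, b) \<mapsto> h1 a + h2 b\<close> maps such pairs to elements with the same \<open>n\<close>-th multiple, once the
  common summand \<open>h1 (f s) + h1 (f t)\<close> is cancelled, hence to equal elements, because the target
  is cancellative and torsion free. So this map factors uniquely through the surjection
  (\<open>factor_through_surjection\<close>).

  The object is an affine semigroup: its generators are the images of those of \<open>S1\<close>
  and \<open>S2\<close>; the image of \<open>S1 \<times>\<times> S2\<close> is cancellative because it lies in a group; and dividing a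
  cancellative monoid by its torsion congruence keeps it cancellative and makes it torsion free.
\<close>

section \<open>Homomorphisms and generators of commutative monoids\<close>

lemma mon_homI:
  assumes "\<And>x. x \<in> carrier M \<Longrightarrow> h x \<in> carrier N"
    and "\<And>x y. x \<in> carrier M \<Longrightarrow> y \<in> carrier M \<Longrightarrow> h (x \<otimes>\<^bsub>M\<^esub> y) = h x \<otimes>\<^bsub>N\<^esub> h y"
    and "h \<one>\<^bsub>M\<^esub> = \<one>\<^bsub>N\<^esub>"
  shows "h \<in> mon_hom M N"
  using assms by (auto simp: mon_hom_def hom_def)

lemma mon_homD:
  assumes "h \<in> mon_hom M N"
  shows "x \<in> carrier M \<Longrightarrow> h x \<in> carrier N"
    and "x \<in> carrier M \<Longrightarrow> y \<in> carrier M \<Longrightarrow> h (x \<otimes>\<^bsub>M\<^esub> y) = h x \<otimes>\<^bsub>N\<^esub> h y"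
    and "h \<one>\<^bsub>M\<^esub> = \<one>\<^bsub>N\<^esub>"
  using assms by (auto simp: mon_hom_def hom_def)

lemma mon_hom_pow:
  assumes "monoid M" "h \<in> mon_hom M N" "x \<in> carrier M"
  shows "h (x [^]\<^bsub>M\<^esub> (n::nat)) = h x [^]\<^bsub>N\<^esub> n"
proof -
  interpret monoid M by fact
  show ?thesis
    by (induction n) (simp_all add: mon_homD[OF assms(2)] assms(3))
qed

lemma comm_monoid_surj_image:
  assumes "comm_monoid M" and h: "h \<in> mon_hom M N" and onto: "h ` carrier M = carrier N"
  shows "comm_monoid N"
proof -
  interpret comm_monoid M by fact
  show ?thesis
  proof (rule comm_monoidI)
    show "\<one>\<^bsub>N\<^esub> \<in> carrier N" using mon_homD[OF h] one_closed by metis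
  next
    fix x y assume "x \<in> carrier N" "y \<in> carrier N"
    then obtain a b where "a \<in> carrier M" "b \<in> carrier M" "x = h a" "y = h b"
      unfolding onto[symmetric] by blast
    then show "x \<otimes>\<^bsub>N\<^esub> y \<in> carrier N" "x \<otimes>\<^bsub>N\<^esub> y = y \<otimes>\<^bsub>N\<^esub> x"
      using mon_homD[OF h] m_comm m_closed by metis+
  next
    fix x y z assume "x \<in> carrier N" "y \<in> carrier N" "z \<in> carrier N"
    then obtain a b c where "a \<in> carrier M" "b \<in> carrier M" "c \<in> carrier M"
      "x = h a" "y = h b" "z = h c"
      unfolding onto[symmetric] by blast
    then show "x \<otimes>\<^bsub>N\<^esub> y \<otimes>\<^bsub>N\<^esub> z = x \<otimes>\<^bsub>N\<^esub> (y \<otimes>\<^bsub>N\<^esub> z)"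
      by (simp add: mon_homD(2)[OF h, symmetric] m_assoc)
  next
    fix x assume "x \<in> carrier N"
    then obtain a where "a \<in> carrier M" "x = h a" unfolding onto[symmetric] by blast
    then show "\<one>\<^bsub>N\<^esub> \<otimes>\<^bsub>N\<^esub> x = x" using mon_homD[OF h] l_one one_closed by metis
  qed
qed

text \<open>For existence, a value of the factored map is computed on any preimage; the
  hypothesis on fibres makes the choice irrelevant. Surjectivity gives uniqueness.\<close>

lemma factor_through_surjection:
  assumes "monoid M" and p: "p \<in> mon_hom M P" and onto: "p ` carrier M = carrier P"
    and k: "k \<in> mon_hom M T"
    and fib: "\<And>x y. x \<in> carrier M \<Longrightarrow> y \<in> carrier M \<Longrightarrow> p x = p y \<Longrightarrow> k x = k y"
  shows "\<exists>!h. h \<in> mon_hom P T \<and> h \<in> extensional (carrier P) \<and> (\<forall>x\<in>carrier M. h (p x) = k x)"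
proof -
  interpret monoid M by fact
  define h where "h = restrict (k \<circ> inv_into (carrier M) p) (carrier P)"
  have hp: "h (p x) = k x" if x: "x \<in> carrier M" for x
  proof -
    have "p x \<in> p ` carrier M" using x by blast
    then have "k (inv_into (carrier M) p (p x)) = k x"
      by (intro fib x inv_into_into f_inv_into_f)
    then show ?thesis using mon_homD(1)[OF p x] by (simp add: h_def)
  qed
  have "h \<in> mon_hom P T"
  proof (rule mon_homI)
    fix u assume "u \<in> carrier P"
    then obtain x where "x \<in> carrier M" "u = p x" unfolding onto[symmetric] by blast
    then show "h u \<in> carrier T" by (simp add: hp mon_homD[OF k])
  next
    fix u v assume "u \<in> carrier P" "v \<in> carrier P"
    then obtain x y where "x \<in> carrier M" "u = p x" "y \<in> carrier M" "v = p y"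
      unfolding onto[symmetric] by blast
    then show "h (u \<otimes>\<^bsub>P\<^esub> v) = h u \<otimes>\<^bsub>T\<^esub> h v"
      by (simp add: hp mon_homD(2)[OF k] mon_homD(2)[OF p, symmetric])
  next
    show "h \<one>\<^bsub>P\<^esub> = \<one>\<^bsub>T\<^esub>"
      using hp[OF one_closed] by (simp add: mon_homD(3)[OF k] mon_homD(3)[OF p])
  qed
  moreover have "h \<in> extensional (carrier P)" by (simp add: h_def)
  moreover have "h' = h"
    if "h' \<in> extensional (carrier P)" "\<forall>x\<in>carrier M. h' (p x) = k x" for h'
  proof (rule extensionalityI)
    show "h' \<in> extensional (carrier P)" by fact
    show "h \<in> extensional (carrier P)" by fact
    fix u assume "u \<in> carrier P"
    then obtain x where "x \<in> carrier M" "u = p x" unfolding onto[symmetric] by blast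
    then show "h' u = h u" using that(2) hp by simp
  qed
  ultimately show ?thesis using hp by blast
qed

lemma fin_gen_monoid_iff:
  assumes "monoid M"
  shows "fin_gen_monoid M \<longleftrightarrow>
    (\<exists>A. finite A \<and> A \<subseteq> carrier M \<and> (\<forall>H. submonoid H M \<longrightarrow> A \<subseteq> H \<longrightarrow> carrier M \<subseteq> H))"
proof -
  interpret monoid M by fact
  have "submonoid (carrier M) M" by unfold_locales auto
  then have eq: "carrier M = \<Inter>{H. submonoid H M \<and> A \<subseteq> H} \<longleftrightarrow>
      (\<forall>H. submonoid H M \<longrightarrow> A \<subseteq> H \<longrightarrow> carrier M \<subseteq> H)" if "A \<subseteq> carrier M" for A
    using that by blast
  show ?thesis
    unfolding fin_gen_monoid_def by (intro ex_cong1 conj_cong refl, rule eq)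
qed

lemma submonoid_vimage:
  assumes "monoid M" "h \<in> mon_hom M N" "submonoid H N"
  shows "submonoid {x \<in> carrier M. h x \<in> H} M"
proof -
  interpret monoid M by fact
  interpret submonoid H N by fact
  show ?thesis by unfold_locales (auto simp: mon_homD[OF assms(2)])
qed

lemma fin_gen_monoid_surj_image:
  assumes M: "monoid M" and N: "monoid N" and h: "h \<in> mon_hom M N"
    and onto: "h ` carrier M = carrier N" and "fin_gen_monoid M"
  shows "fin_gen_monoid N"
proof -
  obtain A where A: "finite A" "A \<subseteq> carrier M"
    and gen: "\<And>H. submonoid H M \<Longrightarrow> A \<subseteq> H \<Longrightarrow> carrier M \<subseteq> H"
    using assms(5) fin_gen_monoid_iff[OF M] by auto
  have "carrier N \<subseteq> H" if "submonoid H N" "h ` A \<subseteq> H" for H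
    using gen[OF submonoid_vimage[OF M h that(1)]] that(2) A(2) unfolding onto[symmetric] by blast
  then show ?thesis
    using A mon_homD(1)[OF h] unfolding fin_gen_monoid_iff[OF N]
    by (intro exI[of _ "h ` A"]) auto
qed

text \<open>A submonoid of the product that contains both axes contains every pair, since
  \<open>(a, b) = (a, 0) + (0, b)\<close>; so generators of the factors, placed on the axes, suffice.\<close>

lemma fin_gen_monoid_DirProd:
  assumes M: "monoid M" and N: "monoid N" and "fin_gen_monoid M" "fin_gen_monoid N"
  shows "fin_gen_monoid (M \<times>\<times> N)"
proof -
  interpret M: monoid M by fact
  interpret N: monoid N by fact
  obtain A where A: "finite A" "A \<subseteq> carrier M"
    and genA: "\<And>H. submonoid H M \<Longrightarrow> A \<subseteq> H \<Longrightarrow> carrier M \<subseteq> H"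
    using assms(3) fin_gen_monoid_iff[OF M] by auto
  obtain B where B: "finite B" "B \<subseteq> carrier N"
    and genB: "\<And>H. submonoid H N \<Longrightarrow> B \<subseteq> H \<Longrightarrow> carrier N \<subseteq> H"
    using assms(4) fin_gen_monoid_iff[OF N] by auto
  let ?G = "A \<times> {\<one>\<^bsub>N\<^esub>} \<union> {\<one>\<^bsub>M\<^esub>} \<times> B"
  have i1: "(\<lambda>a. (a, \<one>\<^bsub>N\<^esub>)) \<in> mon_hom M (M \<times>\<times> N)" by (rule mon_homI) auto
  have i2: "(\<lambda>b. (\<one>\<^bsub>M\<^esub>, b)) \<in> mon_hom N (M \<times>\<times> N)" by (rule mon_homI) auto
  have "carrier (M \<times>\<times> N) \<subseteq> H" if H: "submonoid H (M \<times>\<times> N)" and sub: "?G \<subseteq> H" for H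
  proof
    fix p assume "p \<in> carrier (M \<times>\<times> N)"
    then obtain a b where p: "p = (a, b)" and a: "a \<in> carrier M" and b: "b \<in> carrier N" by auto
    have "(a, \<one>\<^bsub>N\<^esub>) \<in> H" using genA[OF submonoid_vimage[OF M i1 H]] sub A(2) a by blast
    moreover have "(\<one>\<^bsub>M\<^esub>, b) \<in> H" using genB[OF submonoid_vimage[OF N i2 H]] sub B(2) b by blast
    ultimately have "(a, \<one>\<^bsub>N\<^esub>) \<otimes>\<^bsub>M \<times>\<times> N\<^esub> (\<one>\<^bsub>M\<^esub>, b) \<in> H" by (rule submonoid.m_closed[OF H])
    then show "p \<in> H" using a b by (simp add: p)
  qed
  then show ?thesis
    unfolding fin_gen_monoid_iff[OF DirProd_monoid[OF M N]]
    using A B by (intro exI[of _ ?G]) auto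
qed

lemma comm_monoid_DirProd:
  assumes "comm_monoid M" "comm_monoid N"
  shows "comm_monoid (M \<times>\<times> N)"
proof -
  interpret M: comm_monoid M by fact
  interpret N: comm_monoid N by fact
  interpret monoid "M \<times>\<times> N" by (rule DirProd_monoid) unfold_locales
  show ?thesis by unfold_locales (auto simp: M.m_comm N.m_comm)
qed

lemma DirProd_pow:
  "(a, b) [^]\<^bsub>M \<times>\<times> N\<^esub> (n::nat) = (a [^]\<^bsub>M\<^esub> n, b [^]\<^bsub>N\<^esub> n)"
  by (induction n) auto

section \<open>Quotients by congruences\<close>

definition monoid_congruence :: "('a, 'm) monoid_scheme \<Rightarrow> ('a \<times> 'a) set \<Rightarrow> bool" where
  "monoid_congruence M r \<longleftrightarrow> equiv (carrier M) r \<and>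
     (\<forall>x x' y y'. (x, x') \<in> r \<longrightarrow> (y, y') \<in> r \<longrightarrow> (x \<otimes>\<^bsub>M\<^esub> y, x' \<otimes>\<^bsub>M\<^esub> y') \<in> r)"

lemma quot_monoid_mult:
  assumes r: "monoid_congruence M r" and x: "x \<in> carrier M" and y: "y \<in> carrier M"
  shows "r `` {x} \<otimes>\<^bsub>quot_monoid M r\<^esub> r `` {y} = r `` {x \<otimes>\<^bsub>M\<^esub> y}"
proof -
  have eq: "equiv (carrier M) r" using r by (simp add: monoid_congruence_def)
  have "r `` {x' \<otimes>\<^bsub>M\<^esub> y'} = r `` {x \<otimes>\<^bsub>M\<^esub> y}" if "x' \<in> r `` {x}" "y' \<in> r `` {y}" for x' y'
    using that r equiv_class_eq[OF eq, of "x \<otimes>\<^bsub>M\<^esub> y" "x' \<otimes>\<^bsub>M\<^esub> y'"]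
    by (auto simp: monoid_congruence_def)
  moreover have "x \<in> r `` {x}" "y \<in> r `` {y}"
    using equiv_class_self[OF eq] x y by auto
  ultimately have "(\<Union>x'\<in>r `` {x}. \<Union>y'\<in>r `` {y}. r `` {x' \<otimes>\<^bsub>M\<^esub> y'}) = r `` {x \<otimes>\<^bsub>M\<^esub> y}"
    by (metis (no_types, lifting) SUP_eq_const empty_iff)
  then show ?thesis by (simp only: quot_monoid_def monoid.simps)
qed

lemma quot_monoid_proj:
  assumes "monoid M" and r: "monoid_congruence M r"
  shows "(\<lambda>x. r `` {x}) \<in> mon_hom M (quot_monoid M r)"
    and "(\<lambda>x. r `` {x}) ` carrier M = carrier (quot_monoid M r)"
proof -
  show onto: "(\<lambda>x. r `` {x}) ` carrier M = carrier (quot_monoid M r)"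
    by (auto simp: quot_monoid_def quotient_def)
  show "(\<lambda>x. r `` {x}) \<in> mon_hom M (quot_monoid M r)"
  proof (rule mon_homI)
    show "r `` {\<one>\<^bsub>M\<^esub>} = \<one>\<^bsub>quot_monoid M r\<^esub>" by (simp add: quot_monoid_def)
  qed (use onto quot_monoid_mult[OF r] in auto)
qed

lemma comm_monoid_quot_monoid:
  assumes "comm_monoid M" "monoid_congruence M r"
  shows "comm_monoid (quot_monoid M r)"
  using comm_monoid_surj_image[OF assms(1)] quot_monoid_proj assms comm_monoid.axioms(1) by blast

lemma congruence_class_eq_iff:
  assumes "monoid_congruence M r" "x \<in> carrier M" "y \<in> carrier M"
  shows "r `` {x} = r `` {y} \<longleftrightarrow> (x, y) \<in> r"
  using assms eq_equiv_class_iff[of "carrier M" r x y] by (simp add: monoid_congruence_def)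

section \<open>The group of differences\<close>

context comm_monoid_cancel
begin

lemma diff_rel_congruence: "monoid_congruence (G \<times>\<times> G) (diff_rel G)"
  unfolding monoid_congruence_def
proof (intro conjI allI impI)
  show "equiv (carrier (G \<times>\<times> G)) (diff_rel G)"
  proof (rule equivI)
    show "diff_rel G \<subseteq> carrier (G \<times>\<times> G) \<times> carrier (G \<times>\<times> G)" by (auto simp: diff_rel_def)
    show "refl_on (carrier (G \<times>\<times> G)) (diff_rel G)" by (auto simp: refl_on_def diff_rel_def)
    show "sym (diff_rel G)" by (auto simp: sym_def diff_rel_def)
    show "trans (diff_rel G)"
    proof (rule transI)
      fix x y z assume "(x, y) \<in> diff_rel G" "(y, z) \<in> diff_rel G"
      then obtain a b c d e k where xyz: "x = (a, b)" "y = (c, d)" "z = (e, k)"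
        and c: "a \<in> carrier G" "b \<in> carrier G" "c \<in> carrier G" "d \<in> carrier G"
          "e \<in> carrier G" "k \<in> carrier G"
        and eq: "a \<otimes> d = c \<otimes> b" "c \<otimes> k = e \<otimes> d"
        by (auto simp: diff_rel_def)
      have "(a \<otimes> k) \<otimes> d = (a \<otimes> d) \<otimes> k" using c by (simp add: m_ac)
      also have "\<dots> = (c \<otimes> k) \<otimes> b" using c eq(1) by (simp add: m_ac)
      also have "\<dots> = (e \<otimes> b) \<otimes> d" using c eq(2) by (simp add: m_ac)
      finally have "a \<otimes> k = e \<otimes> b" using c by (intro r_cancel[of "a \<otimes> k" d]) auto
      then show "(x, z) \<in> diff_rel G" using c by (simp add: diff_rel_def xyz)
    qed
  qed
next
  fix x x' y y' assume "(x, x') \<in> diff_rel G" "(y, y') \<in> diff_rel G"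
  then obtain a b c d a' b' c' d' where xy: "x = (a, b)" "x' = (c, d)" "y = (a', b')" "y' = (c', d')"
    and c: "a \<in> carrier G" "b \<in> carrier G" "c \<in> carrier G" "d \<in> carrier G"
      "a' \<in> carrier G" "b' \<in> carrier G" "c' \<in> carrier G" "d' \<in> carrier G"
    and eq: "a \<otimes> d = c \<otimes> b" "a' \<otimes> d' = c' \<otimes> b'"
    by (auto simp: diff_rel_def)
  have "(a \<otimes> a') \<otimes> (d \<otimes> d') = (a \<otimes> d) \<otimes> (a' \<otimes> d')" using c by (simp add: m_ac)
  also have "\<dots> = (c \<otimes> c') \<otimes> (b \<otimes> b')" unfolding eq using c by (simp add: m_ac)
  finally show "(x \<otimes>\<^bsub>G \<times>\<times> G\<^esub> y, x' \<otimes>\<^bsub>G \<times>\<times> G\<^esub> y') \<in> diff_rel G"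
    using c by (simp add: diff_rel_def xy)
qed

lemma diff_class_eq_iff:
  assumes "a \<in> carrier G" "b \<in> carrier G" "c \<in> carrier G" "d \<in> carrier G"
  shows "diff_rel G `` {(a, b)} = diff_rel G `` {(c, d)} \<longleftrightarrow> a \<otimes> d = c \<otimes> b"
  using congruence_class_eq_iff[OF diff_rel_congruence, of "(a, b)" "(c, d)"] assms
  by (simp add: diff_rel_def)

lemma Grp_mult:
  assumes "a \<in> carrier G" "b \<in> carrier G" "c \<in> carrier G" "d \<in> carrier G"
  shows "diff_rel G `` {(a, b)} \<otimes>\<^bsub>Grp G\<^esub> diff_rel G `` {(c, d)} = diff_rel G `` {(a \<otimes> c, b \<otimes> d)}"
  using quot_monoid_mult[OF diff_rel_congruence, of "(a, b)" "(c, d)"] assms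
  by (simp add: Grp_def)

lemma Grp_one: "\<one>\<^bsub>Grp G\<^esub> = diff_rel G `` {(\<one>, \<one>)}"
  by (simp add: Grp_def quot_monoid_def)

lemma carrier_Grp:
  "carrier (Grp G) = (\<lambda>(a, b). diff_rel G `` {(a, b)}) ` (carrier G \<times> carrier G)"
  by (auto simp: Grp_def quot_monoid_def quotient_def)

lemma diff_class_in_Grp:
  "a \<in> carrier G \<Longrightarrow> b \<in> carrier G \<Longrightarrow> diff_rel G `` {(a, b)} \<in> carrier (Grp G)"
  by (auto simp: carrier_Grp)

lemma comm_group_Grp: "comm_group (Grp G)"
proof -
  interpret Gr: comm_monoid "Grp G"
    unfolding Grp_def
    by (intro comm_monoid_quot_monoid comm_monoid_DirProd diff_rel_congruence comm_monoid_axioms)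
  have "\<exists>v\<in>carrier (Grp G). v \<otimes>\<^bsub>Grp G\<^esub> u = \<one>\<^bsub>Grp G\<^esub>" if u: "u \<in> carrier (Grp G)" for u
  proof -
    obtain a b where ab: "a \<in> carrier G" "b \<in> carrier G" and [simp]: "u = diff_rel G `` {(a, b)}"
      using u by (auto simp: carrier_Grp)
    show ?thesis
      using ab by (intro bexI[of _ "diff_rel G `` {(b, a)}"])
        (auto simp: Grp_mult Grp_one diff_class_eq_iff diff_class_in_Grp m_comm)
  qed
  then show ?thesis
    by (intro comm_group.intro Gr.comm_monoid_axioms Gr.group_l_invI)
qed

lemma Grp_inv:
  assumes "a \<in> carrier G" "b \<in> carrier G"
  shows "inv\<^bsub>Grp G\<^esub> (diff_rel G `` {(a, b)}) = diff_rel G `` {(b, a)}"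
proof -
  interpret Gr: comm_group "Grp G" by (rule comm_group_Grp)
  show ?thesis
    using assms by (intro Gr.inv_equality)
      (auto simp: Grp_mult Grp_one diff_class_eq_iff diff_class_in_Grp m_comm)
qed

lemma to_Grp_hom: "to_Grp G \<in> mon_hom G (Grp G)"
  by (rule mon_homI) (auto simp: to_Grp_def diff_class_in_Grp Grp_mult Grp_one)

lemma Grp_map_class:
  assumes "comm_monoid_cancel N" and f: "f \<in> mon_hom G N"
    and ab: "a \<in> carrier G" "b \<in> carrier G"
  shows "Grp_map N f (diff_rel G `` {(a, b)}) = diff_rel N `` {(f a, f b)}"
proof -
  interpret N: comm_monoid_cancel N by fact
  have "diff_rel N `` {(f c, f d)} = diff_rel N `` {(f a, f b)}"
    if "((a, b), (c, d)) \<in> diff_rel G" for c d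
  proof -
    have cd: "c \<in> carrier G" "d \<in> carrier G" "a \<otimes> d = c \<otimes> b" using that by (auto simp: diff_rel_def)
    then have "f a \<otimes>\<^bsub>N\<^esub> f d = f c \<otimes>\<^bsub>N\<^esub> f b" using ab by (simp add: mon_homD(2)[OF f, symmetric])
    then show ?thesis using ab cd mon_homD(1)[OF f] by (subst N.diff_class_eq_iff) auto
  qed
  moreover have "((a, b), (a, b)) \<in> diff_rel G" using ab by (simp add: diff_rel_def)
  ultimately show ?thesis unfolding Grp_map_def by fast
qed

end

section \<open>Dividing out torsion\<close>

context comm_monoid_cancel
begin

text \<open>If \<open>m x = m x'\<close> and \<open>n y = n y'\<close>, then the common exponent \<open>m n\<close> serves for the sums.\<close>

lemma tor_rel_congruence: "monoid_congruence G (tor_rel G)"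
  unfolding monoid_congruence_def
proof (intro conjI allI impI)
  show "equiv (carrier G) (tor_rel G)"
  proof (rule equivI)
    show "tor_rel G \<subseteq> carrier G \<times> carrier G" by (auto simp: tor_rel_def)
    show "refl_on (carrier G) (tor_rel G)" by (auto simp: refl_on_def tor_rel_def)
    show "sym (tor_rel G)" by (auto simp: sym_def tor_rel_def)
    show "trans (tor_rel G)"
    proof (rule transI)
      fix x y z assume "(x, y) \<in> tor_rel G" "(y, z) \<in> tor_rel G"
      then obtain m n :: nat where c: "x \<in> carrier G" "y \<in> carrier G" "z \<in> carrier G"
        and mn: "m > 0" "n > 0" "x [^] m = y [^] m" "y [^] n = z [^] n"
        by (auto simp: tor_rel_def)
      have "x [^] (m * n) = y [^] (n * m)"
        using c mn by (simp add: nat_pow_pow[symmetric] mult.commute)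
      also have "\<dots> = z [^] (m * n)"
        using c mn nat_pow_pow[of y n m] nat_pow_pow[of z n m] by (simp add: mult.commute)
      finally show "(x, z) \<in> tor_rel G" using c mn by (auto simp: tor_rel_def intro!: exI[of _ "m * n"])
    qed
  qed
next
  fix x x' y y' assume "(x, x') \<in> tor_rel G" "(y, y') \<in> tor_rel G"
  then obtain m n :: nat where c: "x \<in> carrier G" "x' \<in> carrier G" "y \<in> carrier G" "y' \<in> carrier G"
    and mn: "m > 0" "n > 0" "x [^] m = x' [^] m" "y [^] n = y' [^] n"
    by (auto simp: tor_rel_def)
  have "x [^] (m * n) = x' [^] (m * n)" "y [^] (m * n) = y' [^] (m * n)"
    using c mn nat_pow_pow[of x m n] nat_pow_pow[of x' m n] nat_pow_pow[of y n m] nat_pow_pow[of y' n m]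
    by (simp_all add: mult.commute)
  then have "(x \<otimes> y) [^] (m * n) = (x' \<otimes> y') [^] (m * n)"
    using c by (simp add: nat_pow_distrib)
  then show "(x \<otimes> y, x' \<otimes> y') \<in> tor_rel G"
    using c mn by (auto simp: tor_rel_def intro!: exI[of _ "m * n"])
qed

lemma tor_class_eq_iff:
  assumes "x \<in> carrier G" "y \<in> carrier G"
  shows "tor_rel G `` {x} = tor_rel G `` {y} \<longleftrightarrow> (\<exists>n::nat. n > 0 \<and> x [^] n = y [^] n)"
  using congruence_class_eq_iff[OF tor_rel_congruence assms] assms by (simp add: tor_rel_def)

lemma tor_quot_cancel: "comm_monoid_cancel (quot_monoid G (tor_rel G))"
proof (rule comm_monoid_cancelI)
  let ?Q = "quot_monoid G (tor_rel G)"
  show "comm_monoid ?Q" by (rule comm_monoid_quot_monoid[OF comm_monoid_axioms tor_rel_congruence])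
  fix u v w assume uvw: "u \<in> carrier ?Q" "v \<in> carrier ?Q" "w \<in> carrier ?Q" "u \<otimes>\<^bsub>?Q\<^esub> w = v \<otimes>\<^bsub>?Q\<^esub> w"
  then obtain x y z where c: "x \<in> carrier G" "y \<in> carrier G" "z \<in> carrier G"
    and eq: "u = tor_rel G `` {x}" "v = tor_rel G `` {y}" "w = tor_rel G `` {z}"
    unfolding quot_monoid_proj(2)[OF monoid_axioms tor_rel_congruence, symmetric] by blast
  have "tor_rel G `` {x \<otimes> z} = tor_rel G `` {y \<otimes> z}"
    using uvw(4) c by (simp add: eq quot_monoid_mult[OF tor_rel_congruence])
  then obtain n :: nat where n: "n > 0" "(x \<otimes> z) [^] n = (y \<otimes> z) [^] n"
    using c by (auto simp: tor_class_eq_iff)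
  then have "x [^] n = y [^] n"
    using c by (intro r_cancel[of "x [^] n" "z [^] n"]) (auto simp: nat_pow_distrib)
  then show "u = v" using n c by (auto simp: eq tor_class_eq_iff)
qed

lemma tor_quot_torsion_free: "torsion_free_monoid (quot_monoid G (tor_rel G))"
  unfolding torsion_free_monoid_def
proof (intro ballI allI impI)
  let ?Q = "quot_monoid G (tor_rel G)"
  note proj = quot_monoid_proj[OF monoid_axioms tor_rel_congruence]
  fix u v and n :: nat
  assume uv: "u \<in> carrier ?Q" "v \<in> carrier ?Q" "n > 0" "u [^]\<^bsub>?Q\<^esub> n = v [^]\<^bsub>?Q\<^esub> n"
  then obtain x y where c: "x \<in> carrier G" "y \<in> carrier G"
    and eq: "u = tor_rel G `` {x}" "v = tor_rel G `` {y}"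
    unfolding proj(2)[symmetric] by blast
  have "tor_rel G `` {x [^] n} = tor_rel G `` {y [^] n}"
    using uv(4) c mon_hom_pow[OF monoid_axioms proj(1)] by (simp add: eq)
  then obtain m :: nat where "m > 0" "(x [^] n) [^] m = (y [^] n) [^] m"
    using c by (auto simp: tor_class_eq_iff)
  then have "n * m > 0" "x [^] (n * m) = y [^] (n * m)" using c uv(3) by (auto simp: nat_pow_pow)
  then show "u = v" using c by (auto simp: eq tor_class_eq_iff intro: exI[of _ "n * m"])
qed

end

section \<open>The amalgamated sum\<close>

locale cancel_span =
  S: comm_monoid_cancel S + S1: comm_monoid_cancel S1 + S2: comm_monoid_cancel S2
  for S :: "'s monoid" and S1 :: "'a monoid" and S2 :: "'b monoid" +
  fixes f :: "'s \<Rightarrow> 'a" and g :: "'s \<Rightarrow> 'b"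
  assumes f: "f \<in> mon_hom S S1" and g: "g \<in> mon_hom S S2"
begin

sublocale prod: comm_monoid "S1 \<times>\<times> S2"
  by (rule comm_monoid_DirProd) unfold_locales

sublocale Gr1: comm_group "Grp S1" by (rule S1.comm_group_Grp)

sublocale Gr2: comm_group "Grp S2" by (rule S2.comm_group_Grp)

sublocale Gr: comm_group "Grp S1 \<times>\<times> Grp S2"
proof -
  interpret group "Grp S1 \<times>\<times> Grp S2" by (rule DirProd_group) unfold_locales
  interpret comm_monoid "Grp S1 \<times>\<times> Grp S2" by (rule comm_monoid_DirProd) unfold_locales
  show "comm_group (Grp S1 \<times>\<times> Grp S2)" by unfold_locales
qed

abbreviation "amalg \<equiv> amalg_sum S S1 S2 f g"
abbreviation "\<pi> \<equiv> to_amalg S S1 S2 f g"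
abbreviation "tf_amalg \<equiv> tf_amalg_sum S S1 S2 f g"
abbreviation "\<rho> \<equiv> to_tf_amalg S S1 S2 f g"

lemma f_closed [simp]: "s \<in> carrier S \<Longrightarrow> f s \<in> carrier S1"
  by (rule mon_homD(1)[OF f])

lemma g_closed [simp]: "s \<in> carrier S \<Longrightarrow> g s \<in> carrier S2"
  by (rule mon_homD(1)[OF g])

text \<open>The classes below are \<open>f s - f t\<close> and \<open>- (g s - g t) = g t - g s\<close>.\<close>

lemma antidiag_eq:
  "antidiag S S1 S2 f g =
     (\<lambda>(s, t). (diff_rel S1 `` {(f s, f t)}, diff_rel S2 `` {(g t, g s)})) ` (carrier S \<times> carrier S)"
  unfolding antidiag_def S.carrier_Grp image_image
  by (intro image_cong)
    (auto simp: S.Grp_map_class[OF S1.is_comm_monoid_cancel f]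
        S.Grp_map_class[OF S2.is_comm_monoid_cancel g] S2.Grp_inv)

lemma antidiagI:
  assumes "s \<in> carrier S" "t \<in> carrier S"
  shows "(diff_rel S1 `` {(f s, f t)}, diff_rel S2 `` {(g t, g s)}) \<in> antidiag S S1 S2 f g"
  using assms unfolding antidiag_eq by force

lemma antidiagE:
  assumes "u \<in> antidiag S S1 S2 f g"
  obtains s t where "s \<in> carrier S" "t \<in> carrier S"
    "u = (diff_rel S1 `` {(f s, f t)}, diff_rel S2 `` {(g t, g s)})"
  using assms unfolding antidiag_eq by auto

lemma subgroup_antidiag: "subgroup (antidiag S S1 S2 f g) (Grp S1 \<times>\<times> Grp S2)"
proof (rule Gr.subgroupI)
  show "antidiag S S1 S2 f g \<subseteq> carrier (Grp S1 \<times>\<times> Grp S2)"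
    by (auto elim!: antidiagE simp: S1.diff_class_in_Grp S2.diff_class_in_Grp)
  show "antidiag S S1 S2 f g \<noteq> {}" using antidiagI[of "\<one>\<^bsub>S\<^esub>" "\<one>\<^bsub>S\<^esub>"] by auto
next
  fix u assume "u \<in> antidiag S S1 S2 f g"
  then obtain s t where st: "s \<in> carrier S" "t \<in> carrier S"
    "u = (diff_rel S1 `` {(f s, f t)}, diff_rel S2 `` {(g t, g s)})" by (rule antidiagE)
  then have "inv\<^bsub>Grp S1 \<times>\<times> Grp S2\<^esub> u = (diff_rel S1 `` {(f t, f s)}, diff_rel S2 `` {(g s, g t)})"
    by (simp add: inv_DirProd[OF Gr1.is_group Gr2.is_group] S1.diff_class_in_Grp
        S2.diff_class_in_Grp S1.Grp_inv S2.Grp_inv)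
  then show "inv\<^bsub>Grp S1 \<times>\<times> Grp S2\<^esub> u \<in> antidiag S S1 S2 f g" using st antidiagI by simp
next
  fix u v assume "u \<in> antidiag S S1 S2 f g" "v \<in> antidiag S S1 S2 f g"
  then obtain s t s' t' where st: "s \<in> carrier S" "t \<in> carrier S" "s' \<in> carrier S" "t' \<in> carrier S"
    "u = (diff_rel S1 `` {(f s, f t)}, diff_rel S2 `` {(g t, g s)})"
    "v = (diff_rel S1 `` {(f s', f t')}, diff_rel S2 `` {(g t', g s')})" by (metis antidiagE)
  then have "u \<otimes>\<^bsub>Grp S1 \<times>\<times> Grp S2\<^esub> v =
      (diff_rel S1 `` {(f (s \<otimes>\<^bsub>S\<^esub> s'), f (t \<otimes>\<^bsub>S\<^esub> t'))}, diff_rel S2 `` {(g (t \<otimes>\<^bsub>S\<^esub> t'), g (s \<otimes>\<^bsub>S\<^esub> s'))})"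
    by (simp add: S1.Grp_mult S2.Grp_mult mon_homD(2)[OF f] mon_homD(2)[OF g])
  then show "u \<otimes>\<^bsub>Grp S1 \<times>\<times> Grp S2\<^esub> v \<in> antidiag S S1 S2 f g" using st antidiagI by simp
qed

sublocale Q: comm_group "(Grp S1 \<times>\<times> Grp S2) Mod antidiag S S1 S2 f g"
  by (rule Gr.abelian_FactGroup[OF subgroup_antidiag])

lemma to_amalg_hom_Mod:
  "\<pi> \<in> mon_hom (S1 \<times>\<times> S2) ((Grp S1 \<times>\<times> Grp S2) Mod antidiag S S1 S2 f g)"
proof -
  let ?H = "antidiag S S1 S2 f g"
  interpret normal ?H "Grp S1 \<times>\<times> Grp S2" by (rule Gr.subgroup_imp_normal[OF subgroup_antidiag])
  note hom = r_coset_hom_Mod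
  have c: "(to_Grp S1 a, to_Grp S2 b) \<in> carrier (Grp S1 \<times>\<times> Grp S2)"
    if "a \<in> carrier S1" "b \<in> carrier S2" for a b
    using that mon_homD(1)[OF S1.to_Grp_hom] mon_homD(1)[OF S2.to_Grp_hom] by simp
  show ?thesis
  proof (rule mon_homI)
    fix x assume "x \<in> carrier (S1 \<times>\<times> S2)"
    then show "\<pi> x \<in> carrier ((Grp S1 \<times>\<times> Grp S2) Mod ?H)"
      unfolding to_amalg_def by (intro hom_in_carrier[OF hom] c) auto
  next
    fix x y assume xy: "x \<in> carrier (S1 \<times>\<times> S2)" "y \<in> carrier (S1 \<times>\<times> S2)"
    show "\<pi> (x \<otimes>\<^bsub>S1 \<times>\<times> S2\<^esub> y) = \<pi> x \<otimes>\<^bsub>(Grp S1 \<times>\<times> Grp S2) Mod ?H\<^esub> \<pi> y"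
      using xy unfolding to_amalg_def
      by (subst hom_mult[OF hom, symmetric])
        (auto simp: mon_homD(1,2)[OF S1.to_Grp_hom] mon_homD(1,2)[OF S2.to_Grp_hom])
  next
    show "\<pi> \<one>\<^bsub>S1 \<times>\<times> S2\<^esub> = \<one>\<^bsub>(Grp S1 \<times>\<times> Grp S2) Mod ?H\<^esub>"
      using Gr.coset_mult_one[OF subset]
      by (simp add: to_amalg_def mon_homD(3)[OF S1.to_Grp_hom] mon_homD(3)[OF S2.to_Grp_hom] FactGroup_def)
  qed
qed

lemma to_amalg_hom: "\<pi> \<in> mon_hom (S1 \<times>\<times> S2) amalg"
  by (rule mon_homI) (auto simp: amalg_sum_def mon_homD[OF to_amalg_hom_Mod, simplified])

lemma to_amalg_onto: "\<pi> ` carrier (S1 \<times>\<times> S2) = carrier amalg"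
  by (simp add: amalg_sum_def)

sublocale A: comm_monoid_cancel amalg
proof (rule comm_monoid_cancelI)
  show "comm_monoid amalg"
    by (rule comm_monoid_surj_image[OF prod.comm_monoid_axioms to_amalg_hom to_amalg_onto])
  fix x y z assume "x \<otimes>\<^bsub>amalg\<^esub> z = y \<otimes>\<^bsub>amalg\<^esub> z" "x \<in> carrier amalg" "y \<in> carrier amalg" "z \<in> carrier amalg"
  then show "x = y"
    using Q.r_cancel[of x z y] mon_homD(1)[OF to_amalg_hom_Mod] by (auto simp: amalg_sum_def)
qed

text \<open>Two cosets agree iff their representatives differ by some \<open>(f s - f t, g t - g s)\<close>; clearing
  differences turns this into equations in \<open>S1\<close> and \<open>S2\<close> themselves.\<close>

lemma to_amalg_eq_iff:
  assumes c: "a \<in> carrier S1" "b \<in> carrier S2" "a' \<in> carrier S1" "b' \<in> carrier S2"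
  shows "\<pi> (a, b) = \<pi> (a', b') \<longleftrightarrow>
    (\<exists>s\<in>carrier S. \<exists>t\<in>carrier S. a \<otimes>\<^bsub>S1\<^esub> f t = f s \<otimes>\<^bsub>S1\<^esub> a' \<and> b \<otimes>\<^bsub>S2\<^esub> g s = g t \<otimes>\<^bsub>S2\<^esub> b')"
    (is "_ \<longleftrightarrow> ?R")
proof -
  let ?H = "antidiag S S1 S2 f g" and ?G = "Grp S1 \<times>\<times> Grp S2"
  let ?x = "(to_Grp S1 a, to_Grp S2 b)" and ?y = "(to_Grp S1 a', to_Grp S2 b')"
  have xy: "?x \<in> carrier ?G" "?y \<in> carrier ?G"
    using c mon_homD(1)[OF S1.to_Grp_hom] mon_homD(1)[OF S2.to_Grp_hom] by auto
  have "\<pi> (a, b) = \<pi> (a', b') \<longleftrightarrow> ?x \<in> ?H #>\<^bsub>?G\<^esub> ?y"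
    using Gr.repr_independence[OF _ xy(2) subgroup_antidiag]
      Gr.repr_independenceD[OF subgroup_antidiag xy(1)]
    unfolding to_amalg_def fst_conv snd_conv by metis
  also have "\<dots> \<longleftrightarrow> (\<exists>s\<in>carrier S. \<exists>t\<in>carrier S.
      ?x = (diff_rel S1 `` {(f s, f t)}, diff_rel S2 `` {(g t, g s)}) \<otimes>\<^bsub>?G\<^esub> ?y)"
    unfolding r_coset_def antidiag_eq by fastforce
  also have "\<dots> \<longleftrightarrow> ?R"
    using c by (intro bex_cong refl)
      (simp add: to_Grp_def S1.Grp_mult S2.Grp_mult S1.diff_class_eq_iff S2.diff_class_eq_iff)
  finally show ?thesis .
qed

lemma to_tf_amalg_hom: "\<rho> \<in> mon_hom (S1 \<times>\<times> S2) tf_amalg"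
proof -
  note proj = quot_monoid_proj(1)[OF A.monoid_axioms A.tor_rel_congruence]
  show ?thesis
    unfolding tf_amalg_sum_def to_tf_amalg_def
    by (rule mon_homI) (simp_all only: mon_homD[OF to_amalg_hom] mon_homD[OF proj])
qed

lemma to_tf_amalg_onto: "\<rho> ` carrier (S1 \<times>\<times> S2) = carrier tf_amalg"
  unfolding tf_amalg_sum_def to_tf_amalg_def
    quot_monoid_proj(2)[OF A.monoid_axioms A.tor_rel_congruence, symmetric] to_amalg_onto[symmetric]
  by (simp add: image_image)

lemma to_tf_amalg_eq_iff:
  assumes c: "a \<in> carrier S1" "b \<in> carrier S2" "a' \<in> carrier S1" "b' \<in> carrier S2"
  shows "\<rho> (a, b) = \<rho> (a', b') \<longleftrightarrow>
    (\<exists>n::nat. n > 0 \<and> (\<exists>s\<in>carrier S. \<exists>t\<in>carrier S.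
       a [^]\<^bsub>S1\<^esub> n \<otimes>\<^bsub>S1\<^esub> f t = f s \<otimes>\<^bsub>S1\<^esub> a' [^]\<^bsub>S1\<^esub> n \<and> b [^]\<^bsub>S2\<^esub> n \<otimes>\<^bsub>S2\<^esub> g s = g t \<otimes>\<^bsub>S2\<^esub> b' [^]\<^bsub>S2\<^esub> n))"
proof -
  have pow: "\<pi> (x, y) [^]\<^bsub>amalg\<^esub> n = \<pi> (x [^]\<^bsub>S1\<^esub> n, y [^]\<^bsub>S2\<^esub> n)"
    if "x \<in> carrier S1" "y \<in> carrier S2" for x y and n :: nat
    using mon_hom_pow[OF prod.monoid_axioms to_amalg_hom, of "(x, y)" n] that by (simp add: DirProd_pow)
  have "\<pi> (a, b) \<in> carrier amalg" "\<pi> (a', b') \<in> carrier amalg"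
    using c mon_homD(1)[OF to_amalg_hom] by auto
  then show ?thesis
    unfolding to_tf_amalg_def using c by (simp add: A.tor_class_eq_iff pow to_amalg_eq_iff)
qed

lemma affine_semigroup_tf_amalg:
  assumes "fin_gen_monoid S1" "fin_gen_monoid S2"
  shows "affine_semigroup tf_amalg"
proof -
  have can: "comm_monoid_cancel tf_amalg" "torsion_free_monoid tf_amalg"
    unfolding tf_amalg_sum_def by (rule A.tor_quot_cancel A.tor_quot_torsion_free)+
  interpret P: comm_monoid_cancel tf_amalg by fact
  have "fin_gen_monoid tf_amalg"
    by (rule fin_gen_monoid_surj_image[OF prod.monoid_axioms P.monoid_axioms to_tf_amalg_hom
          to_tf_amalg_onto fin_gen_monoid_DirProd[OF S1.monoid_axioms S2.monoid_axioms assms]])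
  with can show ?thesis by (simp add: affine_semigroup_def)
qed

lemma tf_inj_hom:
  shows "tf_inj1 S S1 S2 f g \<in> mon_hom S1 tf_amalg"
    and "tf_inj2 S S1 S2 f g \<in> mon_hom S2 tf_amalg"
  unfolding tf_inj1_def tf_inj2_def
  by (rule mon_homI; simp add: mon_homD(1)[OF to_tf_amalg_hom] mon_homD(3)[OF to_tf_amalg_hom, simplified]
      flip: mon_homD(2)[OF to_tf_amalg_hom])+

text \<open>The pairs \<open>(f s, 0)\<close> and \<open>(0, g s)\<close> differ by the antidiagonal element of
  \<open>s = s - 0\<close>.\<close>

lemma tf_inj_commute:
  assumes s: "s \<in> carrier S"
  shows "tf_inj1 S S1 S2 f g (f s) = tf_inj2 S S1 S2 f g (g s)"
proof -
  have "\<pi> (f s, \<one>\<^bsub>S2\<^esub>) = \<pi> (\<one>\<^bsub>S1\<^esub>, g s)"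
  proof (subst to_amalg_eq_iff)
    show "\<exists>s'\<in>carrier S. \<exists>t\<in>carrier S. f s \<otimes>\<^bsub>S1\<^esub> f t = f s' \<otimes>\<^bsub>S1\<^esub> \<one>\<^bsub>S1\<^esub> \<and>
        \<one>\<^bsub>S2\<^esub> \<otimes>\<^bsub>S2\<^esub> g s' = g t \<otimes>\<^bsub>S2\<^esub> g s"
      using s mon_homD(3)[OF f] mon_homD(3)[OF g]
      by (intro bexI[of _ s] bexI[of _ "\<one>\<^bsub>S\<^esub>"]) simp_all
  qed (use s in simp_all)
  then show ?thesis by (simp add: tf_inj1_def tf_inj2_def to_tf_amalg_def)
qed

lemma to_tf_amalg_decompose:
  assumes "a \<in> carrier S1" "b \<in> carrier S2"
  shows "\<rho> (a, b) = tf_inj1 S S1 S2 f g a \<otimes>\<^bsub>tf_amalg\<^esub> tf_inj2 S S1 S2 f g b"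
  using assms unfolding tf_inj1_def tf_inj2_def
  by (subst mon_homD(2)[OF to_tf_amalg_hom, symmetric]) auto

section \<open>The universal property\<close>

lemma copair_hom:
  assumes "comm_monoid T" and h1: "h1 \<in> mon_hom S1 T" and h2: "h2 \<in> mon_hom S2 T"
  shows "(\<lambda>(a, b). h1 a \<otimes>\<^bsub>T\<^esub> h2 b) \<in> mon_hom (S1 \<times>\<times> S2) T"
proof -
  interpret T: comm_monoid T by fact
  show ?thesis
    by (rule mon_homI) (auto simp: mon_homD[OF h1] mon_homD[OF h2] T.m_ac)
qed

text \<open>By the commutativity on \<open>S\<close>, the corrections \<open>f s\<close>, \<open>f t\<close> and \<open>g t\<close>, \<open>g s\<close> from the two components
  have the same sum in \<open>T\<close> on either side, so adding the two equations makes them cancel. Torsion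
  freeness then removes the multiple \<open>n\<close>.\<close>

lemma copair_respects_fibres:
  assumes "comm_monoid_cancel T" and tf: "torsion_free_monoid T"
    and h1: "h1 \<in> mon_hom S1 T" and h2: "h2 \<in> mon_hom S2 T"
    and agree: "\<And>s. s \<in> carrier S \<Longrightarrow> h1 (f s) = h2 (g s)"
    and c: "a \<in> carrier S1" "b \<in> carrier S2" "a' \<in> carrier S1" "b' \<in> carrier S2"
    and eq: "\<rho> (a, b) = \<rho> (a', b')"
  shows "h1 a \<otimes>\<^bsub>T\<^esub> h2 b = h1 a' \<otimes>\<^bsub>T\<^esub> h2 b'"
proof -
  interpret T: comm_monoid_cancel T by fact
  note H1 = mon_homD[OF h1] and H2 = mon_homD[OF h2]
  note P1 = mon_hom_pow[OF S1.monoid_axioms h1] and P2 = mon_hom_pow[OF S2.monoid_axioms h2]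
  obtain n :: nat and s t where n: "n > 0" and st: "s \<in> carrier S" "t \<in> carrier S"
    and e1: "a [^]\<^bsub>S1\<^esub> n \<otimes>\<^bsub>S1\<^esub> f t = f s \<otimes>\<^bsub>S1\<^esub> a' [^]\<^bsub>S1\<^esub> n"
    and e2: "b [^]\<^bsub>S2\<^esub> n \<otimes>\<^bsub>S2\<^esub> g s = g t \<otimes>\<^bsub>S2\<^esub> b' [^]\<^bsub>S2\<^esub> n"
    using eq to_tf_amalg_eq_iff[OF c] by auto
  define x y x' y' where "x = h1 a" and "y = h2 b" and "x' = h1 a'" and "y' = h2 b'"
  define u v where "u = h1 (f s)" and "v = h1 (f t)"
  have uv: "u = h2 (g s)" "v = h2 (g t)" using agree st by (auto simp: u_def v_def)
  have cT: "x \<in> carrier T" "y \<in> carrier T" "x' \<in> carrier T" "y' \<in> carrier T"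
    "u \<in> carrier T" "v \<in> carrier T"
    using c st H1(1) H2(1) by (auto simp: x_def y_def x'_def y'_def u_def v_def)
  have E1: "x [^]\<^bsub>T\<^esub> n \<otimes>\<^bsub>T\<^esub> v = u \<otimes>\<^bsub>T\<^esub> x' [^]\<^bsub>T\<^esub> n"
    using arg_cong[OF e1, of h1] c st by (simp add: H1 P1 x_def x'_def u_def v_def)
  have E2: "y [^]\<^bsub>T\<^esub> n \<otimes>\<^bsub>T\<^esub> u = v \<otimes>\<^bsub>T\<^esub> y' [^]\<^bsub>T\<^esub> n"
    using arg_cong[OF e2, of h2] c st by (simp add: H2 P2 y_def y'_def uv)
  have "(x \<otimes>\<^bsub>T\<^esub> y) [^]\<^bsub>T\<^esub> n \<otimes>\<^bsub>T\<^esub> (u \<otimes>\<^bsub>T\<^esub> v)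
      = (x [^]\<^bsub>T\<^esub> n \<otimes>\<^bsub>T\<^esub> v) \<otimes>\<^bsub>T\<^esub> (y [^]\<^bsub>T\<^esub> n \<otimes>\<^bsub>T\<^esub> u)"
    using cT by (simp add: T.nat_pow_distrib T.m_ac)
  also have "\<dots> = (x' \<otimes>\<^bsub>T\<^esub> y') [^]\<^bsub>T\<^esub> n \<otimes>\<^bsub>T\<^esub> (u \<otimes>\<^bsub>T\<^esub> v)"
    unfolding E1 E2 using cT by (simp add: T.nat_pow_distrib T.m_ac)
  finally have "(x \<otimes>\<^bsub>T\<^esub> y) [^]\<^bsub>T\<^esub> n = (x' \<otimes>\<^bsub>T\<^esub> y') [^]\<^bsub>T\<^esub> n"
    by (rule T.r_cancel) (use cT in auto)
  then have "x \<otimes>\<^bsub>T\<^esub> y = x' \<otimes>\<^bsub>T\<^esub> y'"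
    using tf n cT unfolding torsion_free_monoid_def by blast
  then show ?thesis by (simp add: x_def y_def x'_def y'_def)
qed

text \<open>A homomorphism out of the sum is compatible with \<open>h1\<close> and \<open>h2\<close> iff its composite with the
  surjection from \<open>S1 \<times>\<times> S2\<close> is \<open>(a, b) \<mapsto> h1 a + h2 b\<close>, so the universal property is a case of
  factoring through a surjection.\<close>

lemma tf_amalg_universal:
  assumes cT: "comm_monoid_cancel T" and tf: "torsion_free_monoid T"
    and h1: "h1 \<in> mon_hom S1 T" and h2: "h2 \<in> mon_hom S2 T"
    and agree: "\<And>s. s \<in> carrier S \<Longrightarrow> h1 (f s) = h2 (g s)"
  shows "\<exists>!h. h \<in> mon_hom tf_amalg T \<and> h \<in> extensional (carrier tf_amalg) \<and>
      (\<forall>a\<in>carrier S1. h (tf_inj1 S S1 S2 f g a) = h1 a) \<and>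
      (\<forall>b\<in>carrier S2. h (tf_inj2 S S1 S2 f g b) = h2 b)"
proof -
  interpret T: comm_monoid_cancel T by fact
  let ?k = "\<lambda>(a, b). h1 a \<otimes>\<^bsub>T\<^esub> h2 b"
  have compat_iff: "(\<forall>x\<in>carrier (S1 \<times>\<times> S2). h (\<rho> x) = ?k x) \<longleftrightarrow>
      (\<forall>a\<in>carrier S1. h (tf_inj1 S S1 S2 f g a) = h1 a) \<and>
      (\<forall>b\<in>carrier S2. h (tf_inj2 S S1 S2 f g b) = h2 b)"
    if h: "h \<in> mon_hom tf_amalg T" for h
  proof
    assume *: "\<forall>x\<in>carrier (S1 \<times>\<times> S2). h (\<rho> x) = ?k x"
    show "(\<forall>a\<in>carrier S1. h (tf_inj1 S S1 S2 f g a) = h1 a) \<and>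
      (\<forall>b\<in>carrier S2. h (tf_inj2 S S1 S2 f g b) = h2 b)"
      using * by (simp add: tf_inj1_def tf_inj2_def mon_homD(1,3)[OF h1] mon_homD(1,3)[OF h2])
  next
    assume "(\<forall>a\<in>carrier S1. h (tf_inj1 S S1 S2 f g a) = h1 a) \<and>
      (\<forall>b\<in>carrier S2. h (tf_inj2 S S1 S2 f g b) = h2 b)"
    then show "\<forall>x\<in>carrier (S1 \<times>\<times> S2). h (\<rho> x) = ?k x"
      by (auto simp: to_tf_amalg_decompose mon_homD(2)[OF h] mon_homD(1)[OF tf_inj_hom(1)]
          mon_homD(1)[OF tf_inj_hom(2)])
  qed
  have "\<exists>!h. h \<in> mon_hom tf_amalg T \<and> h \<in> extensional (carrier tf_amalg) \<and>
      (\<forall>x\<in>carrier (S1 \<times>\<times> S2). h (\<rho> x) = ?k x)"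
  proof (rule factor_through_surjection[OF prod.monoid_axioms to_tf_amalg_hom to_tf_amalg_onto])
    show "?k \<in> mon_hom (S1 \<times>\<times> S2) T" by (rule copair_hom[OF T.comm_monoid_axioms h1 h2])
    fix x y assume "x \<in> carrier (S1 \<times>\<times> S2)" "y \<in> carrier (S1 \<times>\<times> S2)" "\<rho> x = \<rho> y"
    then show "?k x = ?k y"
      by (cases x; cases y) (simp add: copair_respects_fibres[OF cT tf h1 h2 agree])
  qed
  moreover have "h \<in> mon_hom tf_amalg T \<and> h \<in> extensional (carrier tf_amalg) \<and>
        (\<forall>x\<in>carrier (S1 \<times>\<times> S2). h (\<rho> x) = ?k x) \<longleftrightarrow>
      h \<in> mon_hom tf_amalg T \<and> h \<in> extensional (carrier tf_amalg) \<and>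
        (\<forall>a\<in>carrier S1. h (tf_inj1 S S1 S2 f g a) = h1 a) \<and>
        (\<forall>b\<in>carrier S2. h (tf_inj2 S S1 S2 f g b) = h2 b)" for h
    by (intro conj_cong refl compat_iff)
  ultimately show ?thesis by (simp only:)
qed

end

theorem proposition2p5:
  fixes S :: "'s monoid" and S1 :: "'a monoid" and S2 :: "'b monoid"
    and f :: "'s \<Rightarrow> 'a" and g :: "'s \<Rightarrow> 'b"
  assumes "affine_semigroup S" and "affine_semigroup S1" and "affine_semigroup S2"
    and "f \<in> mon_hom S S1" and "g \<in> mon_hom S S2"
  shows "is_affine_fibered_sum TYPE('t) S S1 S2 f g
           (tf_amalg_sum S S1 S2 f g) (tf_inj1 S S1 S2 f g) (tf_inj2 S S1 S2 f g)"
proof -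
  interpret cancel_span S S1 S2 f g
    using assms by (intro cancel_span.intro cancel_span_axioms.intro) (simp_all add: affine_semigroup_def)
  have "affine_semigroup tf_amalg"
    using assms by (intro affine_semigroup_tf_amalg) (simp_all add: affine_semigroup_def)
  then show ?thesis
    unfolding is_affine_fibered_sum_def
  proof (intro conjI allI impI ballI)
    fix T :: "'t monoid" and h1 h2
    assume T: "affine_semigroup T \<and> h1 \<in> mon_hom S1 T \<and> h2 \<in> mon_hom S2 T \<and>
      (\<forall>s\<in>carrier S. h1 (f s) = h2 (g s))"
    show "\<exists>!h. h \<in> mon_hom tf_amalg T \<and> h \<in> extensional (carrier tf_amalg) \<and>
        (\<forall>a\<in>carrier S1. h (tf_inj1 S S1 S2 f g a) = h1 a) \<and>
        (\<forall>b\<in>carrier S2. h (tf_inj2 S S1 S2 f g b) = h2 b)"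
      by (rule tf_amalg_universal) (use T in \<open>auto simp: affine_semigroup_def\<close>)
  qed (simp_all add: tf_inj_hom tf_inj_commute)
qed

end
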